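(* Let $(X,\mathcal P(A),C+\rho\Omega,P)$ be a regularized model with discount factor $\beta\in(0,1)$ (as described in the context), and suppose that the Lipschitz assumption on $(c,p)$ holds. Then: 1. If $Q_{\mathrm{terminal}}\in\mathcal C_\beta$, then the set $\mathrm{TRMFE}_{Q_{\mathrm{terminal}}}$ is non-empty. 2. Fix $\mu_{\mathrm{initial}}\in\mathcal P(X)$. For every $T\ge 0$ let $Q^T_{\mathrm{terminal}}\in\mathcal C_\beta$ and let $(\pi^T_{-t},\mu^T_{-t})_{t=0}^{T}\in\mathrm{MFE}_{T,\mu_{\mathrm{initial}},Q^T_{\mathrm{terminal}}}$, so that $\mu^T_{-T}=\mu_{\mathrm{initial}}$ for all $T$. Let $\nu\in\mathcal P(X\times\mathcal P(A))$ and extend each finite family of occupancy measures to an infinite one by setting the entry at time $-t$ equal to $\pi^T_{-t}\otimes\mu^T_{-t}$ for $0\le t\le T$ and equal to $\nu$ for $t>T$. If $Q^T_{\mathrm{terminal}}\to Q_{\mathrm{terminal}}$ in $(\mathcal C_\beta,\|\cdot\|_\infty)$ as $T\to\infty$, then any accumulation point, as $T\to\infty$, of these extended families in $\prod_{t=0}^{\infty}\mathcal P(X\times\mathcal P(A))$ (product topology, each factor carrying the topology of weak convergence) induces an element of $\mathrm{TRMFE}_{Q_{\mathrm{terminal}}}$; that is, the accumulation point is of the form $(\pi_{-t}\otimes\mu_{-t})_{t=0}^\infty$ for some $(\pi_{-t},\mu_{-t})_{t=0}^\infty\in\mathrm{TRMFE}_{Q_{\mathrm{terminal}}}$.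
   Context: Setting. $X$ and $A$ are finite nonempty sets with the discrete metric; $\mathcal P(E)$ is the set of probability measures on $E$; $\mathcal P(X)$, $\mathcal P(A)$ carry the norm $\|\cdot\|_1$. $c:X\times A\times\mathcal P(X)\to[0,\infty)$ is a cost function and $p:X\times A\times\mathcal P(X)\to\mathcal P(X)$ a transition kernel. For $u\in\mathcal P(A)$ put $C(x,u,\mu)=\sum_{a}c(x,a,\mu)u(a)$ and $P(\cdot\mid x,u,\mu)=\sum_a p(\cdot\mid x,a,\mu)u(a)$. $\rho>0$ and $\Omega:\mathcal P(A)\to\mathbb R$ is 1-strongly convex for $\|\cdot\|_1$: $\Omega(\theta u+(1-\theta)v)\le\theta\Omega(u)+(1-\theta)\Omega(v)-\frac12\theta(1-\theta)\|u-v\|_1^2$ for $u,v\in\mathcal P(A)$, $\theta\in[0,1]$. Q-functions are functions $Q:X\times\mathcal P(A)\to\mathbb R$. For $Q$ of the form (affine in $u$) $+\rho\Omega(u)$, $Q(x,\cdot)$ is taken to have a unique minimizer $u_Q(x)\in\mathcal P(A)$, and $\pi_Q(\cdot\mid x)=\delta_{u_Q(x)}$. A policy is a kernel $\pi:X\to\mathcal P(\mathcal P(A))$; $\pi\otimes\mu\in\mathcal P(X\times\mathcal P(A))$ denotes $\pi(du\mid x)\mu(dx)$ (occupancy measure). Operators: $$H_1(Q,\mu)(x,u)=C(x,u,\mu)+\rho\Omega(u)+\beta\sum_{y\in X}\min_{v\in\mathcal P(A)}Q(y,v)\,P(y\mid x,u,\mu),$$ $$H_2(\pi,\mu)(\cdot)=\sum_{x\in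 X}\int_{\mathcal P(A)}P(\cdot\mid x,u,\mu)\,\pi(du\mid x)\,\mu(x).$$ Lipschitz assumption. There are constants $L_1,K_1$ such that for all $x,\hat x,a,\hat a,\mu,\hat\mu$: $|c(x,a,\mu)-c(\hat x,\hat a,\hat\mu)|\le L_1(1_{\{x\ne\hat x\}}+2\cdot 1_{\{a\ne\hat a\}}+\|\mu-\hat\mu\|_1)$ and $\|p(\cdot|x,a,\mu)-p(\cdot|\hat x,\hat a,\hat\mu)\|_1\le K_1(1_{\{x\ne\hat x\}}+2\cdot1_{\{a\ne\hat a\}}+\|\mu-\hat\mu\|_1)$. It is understood that $\beta K_1<2$. Domain. $M:=\sup C$. $\tilde{\mathcal C}_\beta$ is the set of $q:X\times A\to\mathbb R_+$ with $\|q\|_\infty\le\frac{M}{1-\beta}$ and $|q(x,a)-q(\tilde x,\tilde a)|\le\frac{L_1}{1-\beta K_1/2}(1_{\{x\ne\tilde x\}}+2\cdot1_{\{a\ne\tilde a\}})$. $\mathcal C_\beta$ is the set of $Q(x,u)=\sum_a q(x,a)u(a)+\rho\Omega(u)$ with $q\in\tilde{\mathcal C}_\beta$. $\mathrm{TRMFE}_{Q_{\mathrm{terminal}}}$ (time-reversed mean-field equilibria): all families $(\pi_{-t},\mu_{-t})_{t=0}^\infty$ of policies and state measures for which there are Q-functions $(Q_{-t})_{t\ge0}$ with $Q_0=Q_{\mathrm{terminal}}$, $Q_{-t-1}=H_1(Q_{-t},\mu_{-t-1})$, $\mu_{-t}=H_2(\pi_{-t-1},\mu_{-t-1})$ for all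 $t\ge0$, and, for all $t\ge0$ and $x\in X$, $\pi_{-t}(\cdot\mid x)$ supported on the minimizers of $Q_{-t}(x,\cdot)$. $\mathrm{MFE}_{T,\mu_{\mathrm{initial}},Q_{\mathrm{terminal}}}$: all families $(\pi_{-t},\mu_{-t})_{t=0}^T$ with $\mu_{-T}=\mu_{\mathrm{initial}}$ for which there are Q-functions $(Q_{-t})_{t=0}^T$ with $Q_0=Q_{\mathrm{terminal}}$, $Q_{-t-1}=H_1(Q_{-t},\mu_{-t-1})$, $\mu_{-t}=H_2(\pi_{-t-1},\mu_{-t-1})$ for $0\le t\le T-1$, and $\pi_{-t}(\cdot\mid x)$ supported on the minimizers of $Q_{-t}(x,\cdot)$ for $0\le t\le T$, $x\in X$. *)

theory Defs
  imports "HOL-Probability.Probability"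
begin

text \<open>
  The finite sets \<open>X\<close> and \<open>A\<close> are the types \<open>'x\<close> and \<open>'a\<close> of class \<open>finite\<close>. A probability measure
  on a finite set is the vector of its point masses, so \<open>\<P>(X)\<close> and \<open>\<P>(A)\<close> are the simplices
  \<open>prob_simplex\<close> in \<open>real ^ 'x\<close> and \<open>real ^ 'a\<close>. Functions with an argument in a simplex are total on
  the vector space; every hypothesis, minimisation and integral below only involves their values
  on the simplex, so the values elsewhere are irrelevant.
\<close>

definition prob_simplex :: "(real ^ 'n) set" where
  "prob_simplex = {u. (\<forall>i. 0 \<le> u $ i) \<and> (\<Sum>i\<in>UNIV. u $ i) = 1}"

definition l1_norm :: "real ^ 'n \<Rightarrow> real" where
  "l1_norm v = (\<Sum>i\<in>UNIV. \<bar>v $ i\<bar>)"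

definition sup_norm :: "'b set \<Rightarrow> ('b \<Rightarrow> real) \<Rightarrow> real" where
  "sup_norm S f = (SUP z\<in>S. \<bar>f z\<bar>)"

subsection \<open>The model\<close>

definition mixed_cost ::
  "('x::finite \<Rightarrow> 'a::finite \<Rightarrow> real ^ 'x \<Rightarrow> real) \<Rightarrow> 'x \<Rightarrow> real ^ 'a \<Rightarrow> real ^ 'x \<Rightarrow> real" where
  "mixed_cost c x u \<mu> = (\<Sum>a\<in>UNIV. c x a \<mu> * u $ a)"

definition mixed_kernel ::
  "('x::finite \<Rightarrow> 'a::finite \<Rightarrow> real ^ 'x \<Rightarrow> real ^ 'x) \<Rightarrow> 'x \<Rightarrow> real ^ 'a \<Rightarrow> real ^ 'x \<Rightarrow> real ^ 'x" where
  "mixed_kernel p x u \<mu> = (\<chi> y. \<Sum>a\<in>UNIV. p x a \<mu> $ y * u $ a)"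

definition strongly_convex_l1 :: "(real ^ 'a::finite \<Rightarrow> real) \<Rightarrow> bool" where
  "strongly_convex_l1 \<Omega> \<longleftrightarrow>
     (\<forall>u\<in>prob_simplex. \<forall>v\<in>prob_simplex. \<forall>\<theta>\<in>{0..1}.
        \<Omega> (\<theta> *\<^sub>R u + (1 - \<theta>) *\<^sub>R v)
          \<le> \<theta> * \<Omega> u + (1 - \<theta>) * \<Omega> v - 1 / 2 * \<theta> * (1 - \<theta>) * (l1_norm (u - v))\<^sup>2)"

text \<open>
  Strong convexity gives uniqueness but not existence of the minimiser, since \<open>\<Omega>\<close> is not assumed
  to be lower semicontinuous at the boundary of the simplex.
\<close>

definition unique_minimizers :: "real \<Rightarrow> (real ^ 'a::finite \<Rightarrow> real) \<Rightarrow> bool" where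
  "unique_minimizers \<rho> \<Omega> \<longleftrightarrow>
     (\<forall>(w :: 'a \<Rightarrow> real) b.
        \<exists>!u. is_arg_min (\<lambda>u. (\<Sum>a\<in>UNIV. w a * u $ a) + b + \<rho> * \<Omega> u) (\<lambda>u. u \<in> prob_simplex) u)"

definition lipschitz_model ::
  "real \<Rightarrow> real \<Rightarrow> ('x::finite \<Rightarrow> 'a::finite \<Rightarrow> real ^ 'x \<Rightarrow> real)
     \<Rightarrow> ('x \<Rightarrow> 'a \<Rightarrow> real ^ 'x \<Rightarrow> real ^ 'x) \<Rightarrow> bool" where
  "lipschitz_model L\<^sub>1 K\<^sub>1 c p \<longleftrightarrow>
     (\<forall>x x' a a'. \<forall>\<mu>\<in>prob_simplex. \<forall>\<mu>'\<in>prob_simplex.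
        \<bar>c x a \<mu> - c x' a' \<mu>'\<bar>
          \<le> L\<^sub>1 * (of_bool (x \<noteq> x') + 2 * of_bool (a \<noteq> a') + l1_norm (\<mu> - \<mu>')) \<and>
        l1_norm (p x a \<mu> - p x' a' \<mu>')
          \<le> K\<^sub>1 * (of_bool (x \<noteq> x') + 2 * of_bool (a \<noteq> a') + l1_norm (\<mu> - \<mu>')))"

definition max_cost :: "('x::finite \<Rightarrow> 'a::finite \<Rightarrow> real ^ 'x \<Rightarrow> real) \<Rightarrow> real" where
  "max_cost c =
     (SUP (x, u, \<mu>) \<in> UNIV \<times> prob_simplex \<times> prob_simplex. mixed_cost c x u \<mu>)"

definition C_tilde ::
  "('x::finite \<Rightarrow> 'a::finite \<Rightarrow> real ^ 'x \<Rightarrow> real) \<Rightarrow> real \<Rightarrow> real \<Rightarrow> real \<Rightarrow> ('x \<Rightarrow> 'a \<Rightarrow> real) set" where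
  "C_tilde c \<beta> L\<^sub>1 K\<^sub>1 =
     {q. (\<forall>x a. 0 \<le> q x a) \<and>
         sup_norm UNIV (\<lambda>(x, a). q x a) \<le> max_cost c / (1 - \<beta>) \<and>
         (\<forall>x x' a a'. \<bar>q x a - q x' a'\<bar>
            \<le> L\<^sub>1 / (1 - \<beta> * K\<^sub>1 / 2) * (of_bool (x \<noteq> x') + 2 * of_bool (a \<noteq> a')))}"

definition C_beta ::
  "('x::finite \<Rightarrow> 'a::finite \<Rightarrow> real ^ 'x \<Rightarrow> real) \<Rightarrow> real \<Rightarrow> real \<Rightarrow> (real ^ 'a \<Rightarrow> real)
     \<Rightarrow> real \<Rightarrow> real \<Rightarrow> ('x \<Rightarrow> real ^ 'a \<Rightarrow> real) set" where
  "C_beta c \<beta> \<rho> \<Omega> L\<^sub>1 K\<^sub>1 =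
     (\<lambda>q x u. (\<Sum>a\<in>UNIV. q x a * u $ a) + \<rho> * \<Omega> u) ` C_tilde c \<beta> L\<^sub>1 K\<^sub>1"

subsection \<open>Policies, occupancy measures and operators\<close>

definition action_space :: "(real ^ 'a::finite) measure" where
  "action_space = restrict_space borel prob_simplex"

text \<open>Since \<open>X\<close> is finite and discrete, this is the Borel sigma-algebra of \<open>X \<times> \<P>(A)\<close>.\<close>

definition state_action_space :: "('x::finite \<times> (real ^ 'a::finite)) measure" where
  "state_action_space = count_space UNIV \<Otimes>\<^sub>M action_space"

definition policies :: "('x::finite \<Rightarrow> (real ^ 'a::finite) measure) set" where
  "policies = count_space UNIV \<rightarrow>\<^sub>M prob_algebra action_space"

definition occupancy ::
  "('x::finite \<Rightarrow> (real ^ 'a::finite) measure) \<Rightarrow> real ^ 'x \<Rightarrow> ('x \<times> (real ^ 'a)) measure" where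
  "occupancy \<pi> \<mu> =
     point_measure UNIV (\<lambda>x. ennreal (\<mu> $ x)) \<bind> (\<lambda>x. distr (\<pi> x) state_action_space (Pair x))"

text \<open>
  The minimum over \<open>v\<close> is written as an infimum; it is attained for \<open>Q\<close> of the form
  (affine in \<open>u\<close>) \<open>+ \<rho> \<Omega>(u)\<close> under \<open>unique_minimizers \<rho> \<Omega>\<close>.
\<close>

definition H1 ::
  "('x::finite \<Rightarrow> 'a::finite \<Rightarrow> real ^ 'x \<Rightarrow> real) \<Rightarrow> ('x \<Rightarrow> 'a \<Rightarrow> real ^ 'x \<Rightarrow> real ^ 'x)
     \<Rightarrow> real \<Rightarrow> real \<Rightarrow> (real ^ 'a \<Rightarrow> real)
     \<Rightarrow> ('x \<Rightarrow> real ^ 'a \<Rightarrow> real) \<Rightarrow> real ^ 'x \<Rightarrow> 'x \<Rightarrow> real ^ 'a \<Rightarrow> real" where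
  "H1 c p \<beta> \<rho> \<Omega> Q \<mu> x u =
     mixed_cost c x u \<mu> + \<rho> * \<Omega> u
       + \<beta> * (\<Sum>y\<in>UNIV. (INF v\<in>prob_simplex. Q y v) * mixed_kernel p x u \<mu> $ y)"

definition H2 ::
  "('x::finite \<Rightarrow> 'a::finite \<Rightarrow> real ^ 'x \<Rightarrow> real ^ 'x)
     \<Rightarrow> ('x \<Rightarrow> (real ^ 'a) measure) \<Rightarrow> real ^ 'x \<Rightarrow> real ^ 'x" where
  "H2 p \<pi> \<mu> = (\<chi> y. \<Sum>x\<in>UNIV. (\<integral>u. mixed_kernel p x u \<mu> $ y \<partial>\<pi> x) * \<mu> $ x)"

definition supported_on_minimizers ::
  "('x::finite \<Rightarrow> (real ^ 'a::finite) measure) \<Rightarrow> ('x \<Rightarrow> real ^ 'a \<Rightarrow> real) \<Rightarrow> bool" where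
  "supported_on_minimizers \<pi> Q \<longleftrightarrow>
     (\<forall>x. AE u in \<pi> x. is_arg_min (Q x) (\<lambda>u. u \<in> prob_simplex) u)"

subsection \<open>Equilibria\<close>

text \<open>The index \<open>t\<close> of a family stands for the time \<open>-t\<close>.\<close>

definition TRMFE ::
  "('x::finite \<Rightarrow> 'a::finite \<Rightarrow> real ^ 'x \<Rightarrow> real) \<Rightarrow> ('x \<Rightarrow> 'a \<Rightarrow> real ^ 'x \<Rightarrow> real ^ 'x)
     \<Rightarrow> real \<Rightarrow> real \<Rightarrow> (real ^ 'a \<Rightarrow> real) \<Rightarrow> ('x \<Rightarrow> real ^ 'a \<Rightarrow> real)
     \<Rightarrow> ((nat \<Rightarrow> 'x \<Rightarrow> (real ^ 'a) measure) \<times> (nat \<Rightarrow> real ^ 'x)) set" where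
  "TRMFE c p \<beta> \<rho> \<Omega> Q_terminal =
     {(\<pi>, \<mu>). (\<forall>t. \<pi> t \<in> policies \<and> \<mu> t \<in> prob_simplex) \<and>
        (\<exists>Q. Q 0 = Q_terminal \<and>
             (\<forall>t. Q (Suc t) = H1 c p \<beta> \<rho> \<Omega> (Q t) (\<mu> (Suc t)) \<and>
                  \<mu> t = H2 p (\<pi> (Suc t)) (\<mu> (Suc t))) \<and>
             (\<forall>t. supported_on_minimizers (\<pi> t) (Q t)))}"

text \<open>Only the entries with index \<open>t \<le> T\<close> are constrained and count as part of the family.\<close>

definition MFE ::
  "('x::finite \<Rightarrow> 'a::finite \<Rightarrow> real ^ 'x \<Rightarrow> real) \<Rightarrow> ('x \<Rightarrow> 'a \<Rightarrow> real ^ 'x \<Rightarrow> real ^ 'x)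
     \<Rightarrow> real \<Rightarrow> real \<Rightarrow> (real ^ 'a \<Rightarrow> real)
     \<Rightarrow> nat \<Rightarrow> real ^ 'x \<Rightarrow> ('x \<Rightarrow> real ^ 'a \<Rightarrow> real)
     \<Rightarrow> ((nat \<Rightarrow> 'x \<Rightarrow> (real ^ 'a) measure) \<times> (nat \<Rightarrow> real ^ 'x)) set" where
  "MFE c p \<beta> \<rho> \<Omega> T \<mu>_initial Q_terminal =
     {(\<pi>, \<mu>). (\<forall>t\<le>T. \<pi> t \<in> policies \<and> \<mu> t \<in> prob_simplex) \<and> \<mu> T = \<mu>_initial \<and>
        (\<exists>Q. Q 0 = Q_terminal \<and>
             (\<forall>t<T. Q (Suc t) = H1 c p \<beta> \<rho> \<Omega> (Q t) (\<mu> (Suc t)) \<and>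
                    \<mu> t = H2 p (\<pi> (Suc t)) (\<mu> (Suc t))) \<and>
             (\<forall>t\<le>T. supported_on_minimizers (\<pi> t) (Q t)))}"

subsection \<open>Weak convergence and accumulation points\<close>

text \<open>
  The topology of weak convergence on the probability measures on a measurable space \<open>M\<close> that
  carries the topology \<open>E\<close>: the coarsest one making \<open>m \<mapsto> \<integral>f dm\<close> continuous for all bounded
  continuous \<open>f\<close>.
\<close>

definition weak_topology :: "'b topology \<Rightarrow> 'b measure \<Rightarrow> 'b measure topology" where
  "weak_topology E M = topology_generated_by
     {{m \<in> space (prob_algebra M). (\<integral>z. f z \<partial>m) \<in> U} | f U.
        continuous_map E euclideanreal f \<and> bounded (f ` topspace E) \<and> open U}"

definition occupancy_topology :: "('x::finite \<times> (real ^ 'a::finite)) measure topology" where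
  "occupancy_topology =
     weak_topology (prod_topology (discrete_topology UNIV) (top_of_set prob_simplex))
       state_action_space"

definition accumulation_point :: "'b topology \<Rightarrow> (nat \<Rightarrow> 'b) \<Rightarrow> 'b \<Rightarrow> bool" where
  "accumulation_point E s z \<longleftrightarrow>
     z \<in> topspace E \<and> (\<forall>U. openin E U \<and> z \<in> U \<longrightarrow> (\<exists>\<^sub>F n in sequentially. s n \<in> U))"

end

theory Submission
  imports Defs
begin

text \<open>
  For \<open>Q\<close> of the form (affine in \<open>u\<close>) \<open>+ \<rho> \<Omega>(u)\<close>, strong convexity makes the minimiser and the minimum
  Lipschitz functions of the affine coefficients, and \<open>H\<^sub>1\<close> preserves this form. Hence all Q-functions
  and all (necessarily deterministic) policies of an equilibrium are determined by the terminal
  coefficients and the state flow, and depend continuously on them in the product topology.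

  Existence: an equilibrium is a fixed point of a continuous self-map of \<open>\<P>(X)\<^sup>\<nat>\<close>, sending a flow to
  the flow that its own best replies induce. Brouwer's theorem for the Hilbert cube gives the fixed
  point at once on the infinite horizon, without limits of finite horizon equilibria.

  Accumulation points: along a filter realising the accumulation point the state marginals converge,
  hence so do the coefficients and the best replies \<open>u\<^sub>t(x)\<close>, and the evolution equations pass to the
  limit. Testing the limit with \<open>min 1 |u - u\<^sub>t(x)|\<close> shows that it is concentrated on the graph
  of \<open>u\<^sub>t\<close>, so it is the occupancy measure of the limiting deterministic policy.
\<close>

subsection \<open>A fixed point theorem for the Hilbert cube\<close>

lemma tendsto_fun_iff:
  fixes g :: "'b \<Rightarrow> 'i \<Rightarrow> 'c::topological_space"
  shows "(g \<longlongrightarrow> l) F \<longleftrightarrow> (\<forall>i. ((\<lambda>n. g n i) \<longlongrightarrow> l i) F)"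
  by (simp flip: limitin_canonical_iff add: euclidean_product_topology[symmetric] limitin_componentwise)

lemma compact_Pi_UNIV:
  fixes S :: "'i \<Rightarrow> 'c::topological_space set"
  assumes "\<And>i. compact (S i)"
  shows "compact {x. \<forall>i. x i \<in> S i}"
proof -
  have "{x. \<forall>i. x i \<in> S i} = PiE UNIV S"
    by (auto simp: PiE_def Pi_def)
  moreover have "compactin (product_topology (\<lambda>_. euclidean) UNIV) (PiE UNIV S)"
    using assms by (simp add: compactin_PiE)
  ultimately show ?thesis
    by (simp add: euclidean_product_topology)
qed

text \<open>
  Kuhn's lemma on the first \<open>n + 1\<close> coordinates and a grid of mesh \<open>1 / (n + 1)\<close>, the other coordinates
  being \<open>0\<close>. Since dimension and mesh grow together, one passage to the limit suffices below.
\<close>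

lemma hilbert_cube_approximate_fixed_point:
  fixes f :: "(nat \<Rightarrow> real) \<Rightarrow> nat \<Rightarrow> real"
  defines "K \<equiv> {x. \<forall>i. x i \<in> {0..1}}"
  assumes maps: "f \<in> K \<rightarrow> K"
  shows "\<exists>q\<in>K. \<forall>i\<le>n. \<exists>a\<in>K. \<exists>b\<in>K. a i \<le> f a i \<and> f b i \<le> b i \<and>
           (\<forall>j. \<bar>a j - q j\<bar> \<le> 1 / real (Suc n) \<and> \<bar>b j - q j\<bar> \<le> 1 / real (Suc n))"
proof -
  define N where "N = Suc n"
  define emb :: "(nat \<Rightarrow> nat) \<Rightarrow> nat \<Rightarrow> real"
    where "emb y i = (if i < N then real (y i) / real N else 0)" for y i
  \<comment> \<open>Kuhn's lemma prescribes the label 0 on the face \<open>y i = 0\<close> and 1 on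
    the face \<open>y i = N\<close>. Both agree with the sign of the displacement because
    \<open>f\<close> stays in the cube: a coordinate equal to 0 cannot decrease and one equal to 1
    cannot increase.\<close>
  define label :: "(nat \<Rightarrow> nat) \<Rightarrow> nat \<Rightarrow> nat"
    where "label y i = (if y i = 0 then 0 else if y i = N then 1
                        else if emb y i \<le> f (emb y) i then 0 else 1)" for y i
  have "0 < N" by (simp add: N_def)
  have emb_K: "emb y \<in> K" if "\<forall>i<N. y i \<le> N" for y
    using that \<open>0 < N\<close> by (auto simp: K_def emb_def divide_simps)
  have f_emb: "0 \<le> f (emb y) i" "f (emb y) i \<le> 1" if "\<forall>i<N. y i \<le> N" for y i
    using maps emb_K[OF that] by (auto simp: K_def)
  have label0: "emb y i \<le> f (emb y) i" if "\<forall>i<N. y i \<le> N" "label y i = 0" for y i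
    using that(2) f_emb[OF that(1), of i] \<open>0 < N\<close>
    by (auto simp: label_def emb_def split: if_splits)
  have label1: "f (emb y) i \<le> emb y i" if "\<forall>i<N. y i \<le> N" "label y i \<noteq> 0" "i < N" for y i
    using that(2,3) f_emb[OF that(1), of i] \<open>0 < N\<close>
    by (auto simp: label_def emb_def split: if_splits)
  obtain q where q: "\<forall>i<N. q i < N"
    and q': "\<forall>i<N. \<exists>r s. (\<forall>j<N. q j \<le> r j \<and> r j \<le> q j + 1) \<and>
               (\<forall>j<N. q j \<le> s j \<and> s j \<le> q j + 1) \<and> label r i \<noteq> label s i"
    by (rule kuhn_lemma[of N N label]) (use \<open>0 < N\<close> in \<open>auto simp: label_def\<close>)
  have grid: "\<forall>i<N. y i \<le> N" if "\<forall>j<N. q j \<le> y j \<and> y j \<le> q j + 1" for y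
    using that q by fastforce
  have near: "\<bar>emb y j - emb q j\<bar> \<le> 1 / real N" if "\<forall>j<N. q j \<le> y j \<and> y j \<le> q j + 1" for y j
  proof (cases "j < N")
    case True
    then have "real (q j) \<le> real (y j)" "real (y j) \<le> real (q j) + 1"
      using that by force+
    with True show ?thesis
      by (auto simp: emb_def diff_divide_distrib[symmetric] divide_right_mono)
  qed (simp add: emb_def)
  have "\<exists>a\<in>K. \<exists>b\<in>K. a i \<le> f a i \<and> f b i \<le> b i \<and>
          (\<forall>j. \<bar>a j - emb q j\<bar> \<le> 1 / real N \<and> \<bar>b j - emb q j\<bar> \<le> 1 / real N)" if "i \<le> n" for i
  proof -
    have "i < N" using that by (simp add: N_def)
    obtain r s where rs: "\<forall>j<N. q j \<le> r j \<and> r j \<le> q j + 1" "\<forall>j<N. q j \<le> s j \<and> s j \<le> q j + 1"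
        "label r i \<noteq> label s i"
      using q' \<open>i < N\<close> by blast
    note g = emb_K[OF grid[OF rs(1)]] emb_K[OF grid[OF rs(2)]] near[OF rs(1)] near[OF rs(2)]
    consider (1) "label r i = 0" "label s i \<noteq> 0" | (2) "label s i = 0" "label r i \<noteq> 0"
      using rs(3) by (metis label_def)
    then show ?thesis
    proof cases
      case 1
      with g label0[OF grid[OF rs(1)]] label1[OF grid[OF rs(2)]] \<open>i < N\<close> show ?thesis
        by blast
    next
      case 2
      with g label0[OF grid[OF rs(2)]] label1[OF grid[OF rs(1)]] \<open>i < N\<close> show ?thesis
        by blast
    qed
  qed
  moreover have "emb q \<in> K"
    using q by (intro emb_K) (simp add: less_imp_le)
  ultimately show ?thesis
    unfolding N_def by blast
qed

text \<open>By compactness the cells at \<open>q n\<close> have a subsequence converging to some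
  \<open>x\<close>. For a fixed coordinate \<open>i\<close>, the two points with opposite
  inequalities exist as soon as \<open>i \<le> n\<close> and lie within the mesh of
  \<open>q n\<close>. Both therefore converge to \<open>x\<close>, and continuity turns the two
  inequalities into \<open>f x i = x i\<close>.\<close>

proposition hilbert_cube_fixed_point:
  fixes f :: "(nat \<Rightarrow> real) \<Rightarrow> nat \<Rightarrow> real"
  defines "K \<equiv> {x. \<forall>i. x i \<in> {0..1}}"
  assumes cont: "continuous_on K f" and maps: "f \<in> K \<rightarrow> K"
  obtains x where "x \<in> K" "f x = x"
proof -
  have "\<forall>n. \<exists>q\<in>K. \<forall>i\<le>n. \<exists>a\<in>K. \<exists>b\<in>K. a i \<le> f a i \<and> f b i \<le> b i \<and>
           (\<forall>j. \<bar>a j - q j\<bar> \<le> 1 / real (Suc n) \<and> \<bar>b j - q j\<bar> \<le> 1 / real (Suc n))"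
    using hilbert_cube_approximate_fixed_point[of f] maps unfolding K_def by blast
  then obtain q where qK: "\<And>n. q n \<in> K"
    and q: "\<And>n i. i \<le> n \<Longrightarrow> \<exists>a\<in>K. \<exists>b\<in>K. a i \<le> f a i \<and> f b i \<le> b i \<and>
           (\<forall>j. \<bar>a j - q n j\<bar> \<le> 1 / real (Suc n) \<and> \<bar>b j - q n j\<bar> \<le> 1 / real (Suc n))"
    by metis
  have "compact K"
    unfolding K_def by (rule compact_Pi_UNIV) simp
  then obtain x r where "x \<in> K" and r: "strict_mono (r :: nat \<Rightarrow> nat)" and lim: "(q \<circ> r) \<longlonglongrightarrow> x"
    using qK unfolding compact_eq_seq_compact_metric seq_compact_def by metis
  have "f x i = x i" for i
  proof -
    \<comment> \<open>For the finitely many \<open>k\<close> with \<open>r k < i\<close> the point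
      \<open>x\<close> serves as a default for \<open>a k\<close> and \<open>b k\<close>, so that
      both sequences stay in \<open>K\<close>.\<close>
    have "\<forall>k. \<exists>a\<in>K. \<exists>b\<in>K. i \<le> r k \<longrightarrow> a i \<le> f a i \<and> f b i \<le> b i \<and>
           (\<forall>j. \<bar>a j - q (r k) j\<bar> \<le> 1 / real (Suc (r k)) \<and> \<bar>b j - q (r k) j\<bar> \<le> 1 / real (Suc (r k)))"
      using q \<open>x \<in> K\<close> by meson
    then obtain a b where ab: "\<And>k. a k \<in> K" "\<And>k. b k \<in> K"
      and ab': "\<And>k. i \<le> r k \<Longrightarrow> a k i \<le> f (a k) i \<and> f (b k) i \<le> b k i \<and>
           (\<forall>j. \<bar>a k j - q (r k) j\<bar> \<le> 1 / real (Suc (r k)) \<and> \<bar>b k j - q (r k) j\<bar> \<le> 1 / real (Suc (r k)))"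
      by metis
    have ev: "\<forall>\<^sub>F k in sequentially. i \<le> r k"
      using filterlim_subseq[OF r] by (simp add: filterlim_at_top)
    have small: "(\<lambda>k. 1 / real (Suc (r k))) \<longlonglongrightarrow> 0"
      by (intro filterlim_compose[OF _ filterlim_subseq[OF r], of "\<lambda>n. 1 / real (Suc n)"])
         (simp add: LIMSEQ_inverse_real_of_nat flip: inverse_eq_divide del: of_nat_Suc)
    have tends: "d \<longlonglongrightarrow> x"
      if "\<And>k j. i \<le> r k \<Longrightarrow> \<bar>d k j - q (r k) j\<bar> \<le> 1 / real (Suc (r k))" for d
      unfolding tendsto_fun_iff
    proof
      fix j
      have "(\<lambda>k. d k j - q (r k) j) \<longlonglongrightarrow> 0"
        by (rule Lim_null_comparison[OF _ small]) (use ev that in \<open>auto elim!: eventually_mono\<close>)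
      moreover have "(\<lambda>k. q (r k) j) \<longlonglongrightarrow> x j"
        using lim by (simp add: tendsto_fun_iff)
      ultimately show "(\<lambda>k. d k j) \<longlonglongrightarrow> x j"
        using tendsto_add by fastforce
    qed
    have "a \<longlonglongrightarrow> x" "b \<longlonglongrightarrow> x"
      using ab' by (auto intro!: tends)
    moreover have "(\<lambda>k. f (a k)) \<longlonglongrightarrow> f x" "(\<lambda>k. f (b k)) \<longlonglongrightarrow> f x"
      using calculation ab \<open>x \<in> K\<close> by (auto intro!: continuous_on_tendsto_compose[OF cont])
    ultimately have *: "(\<lambda>k. a k i) \<longlonglongrightarrow> x i" "(\<lambda>k. f (a k) i) \<longlonglongrightarrow> f x i"
        "(\<lambda>k. b k i) \<longlonglongrightarrow> x i" "(\<lambda>k. f (b k) i) \<longlonglongrightarrow> f x i"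
      by (auto simp: tendsto_fun_iff)
    show ?thesis
    proof (rule antisym)
      show "x i \<le> f x i"
        by (rule tendsto_le[OF _ *(2,1)]) (use ev ab' in \<open>auto elim!: eventually_mono\<close>)
      show "f x i \<le> x i"
        by (rule tendsto_le[OF _ *(3,4)]) (use ev ab' in \<open>auto elim!: eventually_mono\<close>)
    qed
  qed
  then show ?thesis
    using \<open>x \<in> K\<close> by (intro that) auto
qed

subsection \<open>The simplex\<close>

lemma l1_norm_nonneg: "0 \<le> l1_norm v"
  by (simp add: l1_norm_def sum_nonneg)

lemma l1_norm_minus_commute: "l1_norm (u - v) = l1_norm (v - u)"
  by (simp add: l1_norm_def abs_minus_commute)

lemma norm_le_l1_norm: "norm v \<le> l1_norm v"
  unfolding l1_norm_def by (rule norm_le_l1_cart)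

lemma tendsto_l1_norm_diff:
  assumes "(\<mu> \<longlongrightarrow> m) F"
  shows "((\<lambda>n. l1_norm (\<mu> n - m)) \<longlongrightarrow> 0) F"
proof -
  have "((\<lambda>n. l1_norm (\<mu> n - m)) \<longlongrightarrow> l1_norm (m - m)) F"
    unfolding l1_norm_def by (intro tendsto_intros assms)
  then show ?thesis by (simp add: l1_norm_def)
qed

lemma tendsto_via_l1_norm:
  assumes "\<forall>\<^sub>F n in F. l1_norm (f n - l) \<le> g n" and "(g \<longlongrightarrow> 0) F"
  shows "(f \<longlongrightarrow> l) F"
proof (rule Lim_transform2[OF tendsto_const], rule Lim_null_comparison[OF _ assms(2)])
  show "\<forall>\<^sub>F n in F. norm (l - f n) \<le> g n"
    using assms(1) by eventually_elim (metis norm_le_l1_norm norm_minus_commute order_trans)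
qed

lemma axis_in_prob_simplex: "axis a 1 \<in> prob_simplex"
  by (simp add: prob_simplex_def axis_def)

lemma closed_prob_simplex: "closed prob_simplex"
  unfolding prob_simplex_def
  by (intro closed_Collect_conj closed_Collect_all closed_Collect_le closed_Collect_eq continuous_intros)

text \<open>Exchanging the two sums shows that the total mass stays 1. A state transition applies
  this twice, over the actions and over the states.\<close>

lemma prob_simplex_combination:
  assumes "v \<in> prob_simplex" "\<And>a. P a \<in> prob_simplex"
  shows "(\<chi> y. \<Sum>a\<in>UNIV. P a $ y * v $ a) \<in> prob_simplex"
proof -
  have "(\<Sum>y\<in>UNIV. \<Sum>a\<in>UNIV. P a $ y * v $ a) = (\<Sum>a\<in>UNIV. (\<Sum>y\<in>UNIV. P a $ y) * v $ a)"
    by (subst sum.swap) (simp add: sum_distrib_right)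
  with assms show ?thesis
    by (auto simp: prob_simplex_def intro!: sum_nonneg)
qed

lemma convex_prob_simplex: "convex prob_simplex"
  by (auto simp: convex_def prob_simplex_def sum.distrib simp flip: sum_distrib_left)

lemma prob_simplex_component:
  assumes "v \<in> prob_simplex"
  shows "v $ i \<in> {0..1}"
  using assms member_le_sum[of i UNIV "\<lambda>i. v $ i"] by (auto simp: prob_simplex_def)

text \<open>A weak form of Hoelder's inequality, with the sum of the \<open>\<bar>d a\<bar>\<close>
  in place of their maximum; it suffices for the continuity estimates below.\<close>

lemma sum_mult_le_l1:
  fixes d :: "'a::finite \<Rightarrow> real"
  shows "\<bar>\<Sum>a\<in>UNIV. d a * v $ a\<bar> \<le> (\<Sum>a\<in>UNIV. \<bar>d a\<bar>) * l1_norm v"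
proof -
  have "\<bar>\<Sum>a\<in>UNIV. d a * v $ a\<bar> \<le> (\<Sum>a\<in>UNIV. \<bar>d a\<bar> * \<bar>v $ a\<bar>)"
    by (metis (mono_tags, lifting) abs_mult sum.cong sum_abs)
  also have "\<dots> \<le> (\<Sum>a\<in>UNIV. \<bar>d a\<bar> * l1_norm v)"
    unfolding l1_norm_def by (intro sum_mono mult_left_mono member_le_sum) auto
  finally show ?thesis by (simp add: sum_distrib_right)
qed

lemma l1_norm_prob_simplex: "v \<in> prob_simplex \<Longrightarrow> l1_norm v = 1"
  by (simp add: prob_simplex_def l1_norm_def)

subsection \<open>Occupancy measures of deterministic policies\<close>

lemma space_action_space: "space action_space = prob_simplex"
  by (simp add: action_space_def space_restrict_space)

lemma space_state_action_space: "space state_action_space = UNIV \<times> prob_simplex"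
  by (simp add: state_action_space_def space_pair_measure space_action_space)

lemma borel_measurable_action_space:
  assumes "continuous_on prob_simplex f"
  shows "f \<in> borel_measurable action_space"
  unfolding action_space_def using assms by (rule borel_measurable_continuous_on_restrict)

lemma measurable_state_action_spaceI:
  assumes "\<And>x. (\<lambda>v. f (x, v)) \<in> action_space \<rightarrow>\<^sub>M N"
  shows "f \<in> state_action_space \<rightarrow>\<^sub>M N"
  unfolding state_action_space_def
  by (rule measurable_pair_measure_countable1) (use assms in auto)

lemma measurable_graph:
  assumes "\<And>x. g x \<in> prob_simplex"
  shows "(\<lambda>x. (x, g x)) \<in> count_space UNIV \<rightarrow>\<^sub>M state_action_space"
  using assms by (auto simp: space_state_action_space)

lemma measurable_fst_state_action_space:
  "fst \<in> state_action_space \<rightarrow>\<^sub>M count_space UNIV"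
  unfolding state_action_space_def by simp

text \<open>This makes equilibrium policies deterministic: where the minimiser is unique, a policy
  supported on the minimisers is a Dirac mass.\<close>

lemma eq_return_if_AE_const:
  assumes "M \<in> space (prob_algebra N)" "g \<in> space N" "AE u in M. u = g"
  shows "M = return N g"
proof -
  interpret prob_space M using assms(1) by (simp add: space_prob_algebra)
  have sets: "sets M = sets N" using assms(1) by (simp add: space_prob_algebra)
  have "M = distr M N (\<lambda>u. u)"
    using sets by (simp add: distr_id2)
  also have "\<dots> = distr M N (\<lambda>_. g)"
    using assms sets by (intro distr_cong_AE) (auto simp: measurable_ident_sets)
  also have "\<dots> = return N g"
    using assms(2) by (intro measure_eqI) (auto simp: emeasure_distr emeasure_space_1 split: split_indicator)
  finally show ?thesis .
qed

lemma return_policies: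
  "(\<And>x. g x \<in> prob_simplex) \<Longrightarrow> (\<lambda>x. return action_space (g x)) \<in> policies"
  by (auto simp: policies_def space_prob_algebra space_action_space prob_space_return)

lemma occupancy_return:
  assumes "\<And>x. g x \<in> prob_simplex"
  shows "occupancy (\<lambda>x. return action_space (g x)) \<mu> =
    distr (point_measure UNIV (\<lambda>x. ennreal (\<mu> $ x))) state_action_space (\<lambda>x. (x, g x))"
proof -
  have "distr (return action_space (g x)) state_action_space (Pair x)
      = return state_action_space (x, g x)" for x
    using assms
    by (intro distr_return) (auto simp: state_action_space_def space_action_space)
  moreover have "(\<lambda>x. (x, g x)) \<in> point_measure UNIV (\<lambda>x. ennreal (\<mu> $ x)) \<rightarrow>\<^sub>M state_action_space"
    using measurable_graph[OF assms] by (simp add: point_measure_def)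
  ultimately show ?thesis
    unfolding occupancy_def by (simp add: bind_return_distr' space_point_measure)
qed

lemma integral_occupancy_return:
  fixes f :: "_ \<Rightarrow> real"
  assumes "\<And>x. g x \<in> prob_simplex" "\<mu> \<in> prob_simplex" "f \<in> borel_measurable state_action_space"
  shows "(\<integral>w. f w \<partial>occupancy (\<lambda>x. return action_space (g x)) \<mu>) = (\<Sum>x\<in>UNIV. \<mu> $ x * f (x, g x))"
proof -
  have "(\<lambda>x. (x, g x)) \<in> point_measure UNIV (\<lambda>x. ennreal (\<mu> $ x)) \<rightarrow>\<^sub>M state_action_space"
    using measurable_graph[OF assms(1)] by (simp add: point_measure_def)
  then show ?thesis
    using assms(2,3)
    by (simp add: occupancy_return[OF assms(1)] integral_distr lebesgue_integral_point_measure_finite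
        prob_simplex_def mult.commute)
qed

text \<open>A measure concentrated on the graph of \<open>g\<close> is the image of its own first
  marginal under \<open>x \<mapsto> (x, g x)\<close>. The marginal enters through integrals because
  these are what weak convergence controls.\<close>

lemma eq_occupancy_returnI:
  fixes z :: "('x::finite \<times> (real ^ 'a::finite)) measure"
  assumes z: "z \<in> space (prob_algebra state_action_space)"
    and g: "\<And>x. g x \<in> prob_simplex"
    and \<mu>: "\<And>x. (\<integral>w. of_bool (fst w = x) \<partial>z) = \<mu> $ x"
    and AE: "AE w in z. snd w = g (fst w)"
  shows "z = occupancy (\<lambda>x. return action_space (g x)) \<mu>"
proof -
  interpret prob_space z using z by (simp add: space_prob_algebra)
  have sets: "sets z = sets state_action_space" using z by (simp add: space_prob_algebra)
  have fst_z: "fst \<in> z \<rightarrow>\<^sub>M count_space UNIV"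
    using measurable_fst_state_action_space measurable_cong_sets[OF sets refl] by blast
  note graph = measurable_graph[of g, OF g]
  have "z = distr z state_action_space (\<lambda>w. w)"
    using sets by (simp add: distr_id2)
  also have "\<dots> = distr z state_action_space (\<lambda>w. (fst w, g (fst w)))"
    using AE sets measurable_compose[OF fst_z graph]
    by (intro distr_cong_AE) (auto simp: measurable_ident_sets prod_eq_iff elim!: eventually_mono)
  also have "\<dots> = distr (distr z (count_space UNIV) fst) state_action_space (\<lambda>x. (x, g x))"
    using graph fst_z by (simp add: distr_distr comp_def)
  also have "distr z (count_space UNIV) fst = point_measure UNIV (\<lambda>x. ennreal (\<mu> $ x))"
  proof (rule measure_eqI_finite)
    fix x :: 'x
    have "(\<integral>w. of_bool (fst w = x) \<partial>z) = (\<integral>w. indicator (fst -` {x}) w \<partial>z)"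
      by (intro Bochner_Integration.integral_cong) (auto split: split_indicator)
    also have "\<dots> = measure z (fst -` {x} \<inter> space z)"
      by simp
    finally show "emeasure (distr z (count_space UNIV) fst) {x}
        = emeasure (point_measure UNIV (\<lambda>x. ennreal (\<mu> $ x))) {x}"
      using fst_z \<mu>[of x] by (simp add: emeasure_distr emeasure_eq_measure emeasure_point_measure_finite)
  qed (auto simp: sets_point_measure)
  finally show ?thesis
    using occupancy_return[of g, OF g] by metis
qed

subsection \<open>Accumulation points in the weak topology\<close>

text \<open>
  A filter takes the place of a convergent subsequence, so that metrizability of the weak topology
  is not an issue.
\<close>

lemma accumulation_point_imp_limitin:
  assumes "accumulation_point E s z"
  obtains F where "F \<noteq> bot" "F \<le> sequentially" "limitin E s z F"
proof -
  \<comment> \<open>The tails of the sequence are cut down to the indices \<open>n\<close> with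
    \<open>s n\<close> in a given neighbourhood of \<open>z\<close>. Such an intersection is never
    empty because \<open>s\<close> visits each neighbourhood frequently, so the filter is
    proper.\<close>
  define F where "F = inf sequentially (filtercomap s (nhdsin E z))"
  have z: "z \<in> topspace E" using assms by (simp add: accumulation_point_def)
  show thesis
  proof
    show "F \<noteq> bot"
    proof
      assume "F = bot"
      then have "eventually (\<lambda>_. False) F" by simp
      then obtain P Q U where "eventually P sequentially" "\<And>n. Q (s n) \<Longrightarrow> P n \<Longrightarrow> False"
          "openin E U" "z \<in> U" "\<And>y. y \<in> U \<Longrightarrow> Q y"
        unfolding F_def eventually_inf eventually_filtercomap eventually_nhdsin using z by metis
      then have "\<not> (\<exists>\<^sub>F n in sequentially. s n \<in> U)"
        unfolding frequently_def not_not by (metis (mono_tags, lifting) eventually_mono)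
      with \<open>openin E U\<close> \<open>z \<in> U\<close> show False
        using assms by (auto simp: accumulation_point_def)
    qed
    show "limitin E s z F"
      unfolding limitin_def F_def
    proof (intro conjI z allI impI)
      fix U assume "openin E U \<and> z \<in> U"
      then have "eventually (\<lambda>y. y \<in> U) (nhdsin E z)"
        using z by (auto simp: eventually_nhdsin)
      then have "eventually (\<lambda>n. s n \<in> U) (filtercomap s (nhdsin E z))"
        by (rule eventually_filtercomapI)
      then show "eventually (\<lambda>n. s n \<in> U) (inf sequentially (filtercomap s (nhdsin E z)))"
        using filter_leD inf.cobounded2 by blast
    qed
  qed (simp add: F_def)
qed

lemma topspace_weak_topology_subset: "topspace (weak_topology E M) \<subseteq> space (prob_algebra M)"
  by (auto simp: weak_topology_def topology_generated_by_topspace)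

lemma limitin_weak_topology_integral:
  fixes f :: "'b \<Rightarrow> real"
  assumes lim: "limitin (weak_topology E M) s z F"
    and f: "continuous_map E euclideanreal f" "bounded (f ` topspace E)"
  shows "((\<lambda>n. \<integral>w. f w \<partial>s n) \<longlongrightarrow> (\<integral>w. f w \<partial>z)) F"
proof (rule topological_tendstoI)
  fix U :: "real set" assume U: "open U" "(\<integral>w. f w \<partial>z) \<in> U"
  let ?V = "{m \<in> space (prob_algebra M). (\<integral>w. f w \<partial>m) \<in> U}"
  have z: "z \<in> space (prob_algebra M)"
    using limitin_topspace[OF lim]
    using topspace_weak_topology_subset by blast
  have "openin (weak_topology E M) ?V"
    unfolding weak_topology_def openin_topology_generated_by_iff
    by (rule generate_topology_on.Basis) (use f U in blast)
  then have "\<forall>\<^sub>F n in F. s n \<in> ?V"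
    using lim z U by (auto simp: limitin_def)
  then show "\<forall>\<^sub>F n in F. (\<integral>w. f w \<partial>s n) \<in> U"
    by (rule eventually_mono) simp
qed

text \<open>A discrete first factor cuts the product into open slices, so continuity can be checked
  in the second variable alone.\<close>

lemma continuous_map_prod_discrete:
  assumes "\<And>x. x \<in> X \<Longrightarrow> continuous_map E Z (\<lambda>v. f (x, v))"
  shows "continuous_map (prod_topology (discrete_topology X) E) Z f"
  unfolding continuous_map
proof (intro conjI allI impI)
  show "f ` topspace (prod_topology (discrete_topology X) E) \<subseteq> topspace Z"
    using assms by (fastforce simp: continuous_map)
  fix U assume U: "openin Z U"
  have "{w \<in> topspace (prod_topology (discrete_topology X) E). f w \<in> U}
      = (\<Union>x\<in>X. {x} \<times> {v \<in> topspace E. f (x, v) \<in> U})"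
    by auto
  moreover have "openin E {v \<in> topspace E. f (x, v) \<in> U}" if "x \<in> X" for x
    using assms[OF that] U by (simp add: continuous_map)
  ultimately show "openin (prod_topology (discrete_topology X) E)
      {w \<in> topspace (prod_topology (discrete_topology X) E). f w \<in> U}"
    by (auto simp: openin_prod_Times_iff intro!: openin_Union)
qed

lemma limitin_occupancy_topology_integral:
  fixes f :: "'x::finite \<times> (real ^ 'a::finite) \<Rightarrow> real"
  assumes "limitin occupancy_topology s z F"
    and "\<And>x. continuous_on prob_simplex (\<lambda>v. f (x, v))" and "\<And>w. \<bar>f w\<bar> \<le> B"
  shows "((\<lambda>n. \<integral>w. f w \<partial>s n) \<longlongrightarrow> (\<integral>w. f w \<partial>z)) F"
proof (rule limitin_weak_topology_integral)
  show "limitin (weak_topology (prod_topology (discrete_topology UNIV) (top_of_set prob_simplex))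
          state_action_space) s z F"
    using assms(1) by (simp add: occupancy_topology_def)
  show "continuous_map (prod_topology (discrete_topology UNIV) (top_of_set prob_simplex)) euclideanreal f"
    using assms(2) by (intro continuous_map_prod_discrete) simp
  show "bounded (f ` topspace (prod_topology (discrete_topology UNIV) (top_of_set prob_simplex)))"
    using assms(3) by (auto intro!: boundedI)
qed

subsection \<open>Regularized models\<close>

locale regularized_model =
  fixes c :: "'x::finite \<Rightarrow> 'a::finite \<Rightarrow> real ^ 'x \<Rightarrow> real"
    and p :: "'x \<Rightarrow> 'a \<Rightarrow> real ^ 'x \<Rightarrow> real ^ 'x"
    and \<Omega> :: "real ^ 'a \<Rightarrow> real"
    and \<beta> \<rho> L K :: real
  assumes rho_pos: "0 < \<rho>"
    and kernel: "\<And>x a \<mu>. \<mu> \<in> prob_simplex \<Longrightarrow> p x a \<mu> \<in> prob_simplex"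
    and strongly_convex: "strongly_convex_l1 \<Omega>"
    and unique_min: "unique_minimizers \<rho> \<Omega>"
    and lipschitz: "lipschitz_model L K c p"
begin

section \<open>Minimisers of a linear cost plus regulariser\<close>

text \<open>One state's section of a Q-function, parametrised by its coefficients. There is no
  constant term: on the simplex, where the entries of \<open>u\<close> sum to 1, a constant can be
  absorbed into \<open>w\<close>.\<close>

definition reg_cost :: "('a \<Rightarrow> real) \<Rightarrow> real ^ 'a \<Rightarrow> real" where
  "reg_cost w u = (\<Sum>a\<in>UNIV. w a * u $ a) + \<rho> * \<Omega> u"

definition best :: "('a \<Rightarrow> real) \<Rightarrow> real ^ 'a" where
  "best w = (THE u. is_arg_min (reg_cost w) (\<lambda>u. u \<in> prob_simplex) u)"

lemma is_arg_min_reg_cost_iff: "is_arg_min (reg_cost w) (\<lambda>u. u \<in> prob_simplex) u \<longleftrightarrow> u = best w"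
proof -
  have "reg_cost w = (\<lambda>u. (\<Sum>a\<in>UNIV. w a * u $ a) + 0 + \<rho> * \<Omega> u)"
    by (simp add: reg_cost_def fun_eq_iff)
  then have "\<exists>!u. is_arg_min (reg_cost w) (\<lambda>u. u \<in> prob_simplex) u"
    using unique_min[unfolded unique_minimizers_def, rule_format, of w 0] by simp
  then show ?thesis
    unfolding best_def by (metis the1_equality theI')
qed

lemma best_in: "best w \<in> prob_simplex"
  using is_arg_min_reg_cost_iff[of w "best w"] by (simp add: is_arg_min_def)

lemma reg_cost_best_le: "v \<in> prob_simplex \<Longrightarrow> reg_cost w (best w) \<le> reg_cost w v"
  using is_arg_min_reg_cost_iff[of w "best w"] by (auto simp: is_arg_min_linorder)

lemma INF_reg_cost: "(INF v\<in>prob_simplex. reg_cost w v) = reg_cost w (best w)"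
  by (rule cInf_eq_minimum) (auto simp: best_in reg_cost_best_le)

lemma reg_cost_diff: "reg_cost w u - reg_cost w' u = (\<Sum>a\<in>UNIV. (w a - w' a) * u $ a)"
  by (simp add: reg_cost_def sum_subtractf left_diff_distrib)

text \<open>Strong convexity at the midpoint, \<open>\<theta> = 1/2\<close>: the midpoint costs at
  least the minimum, so half the excess cost of \<open>v\<close> is at least
  \<open>\<rho> / 8\<close> times the squared distance.\<close>

lemma reg_cost_growth:
  assumes "v \<in> prob_simplex"
  shows "reg_cost w (best w) + \<rho> / 4 * (l1_norm (best w - v))\<^sup>2 \<le> reg_cost w v"
proof -
  let ?u = "best w" and ?m = "(1/2) *\<^sub>R best w + (1 - 1/2) *\<^sub>R v"
  have "?m \<in> prob_simplex"
    by (rule convexD[OF convex_prob_simplex best_in assms]) auto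
  then have 1: "reg_cost w ?u \<le> reg_cost w ?m" by (rule reg_cost_best_le)
  have "\<Omega> ?m \<le> 1/2 * \<Omega> ?u + (1 - 1/2) * \<Omega> v - 1/2 * (1/2) * (1 - 1/2) * (l1_norm (?u - v))\<^sup>2"
    by (rule strongly_convex[unfolded strongly_convex_l1_def, rule_format, OF best_in assms]) simp
  then have "\<rho> * \<Omega> ?m \<le> \<rho> * (1/2 * \<Omega> ?u + 1/2 * \<Omega> v - 1/8 * (l1_norm (?u - v))\<^sup>2)"
    using rho_pos by (intro mult_left_mono) auto
  moreover have "(\<Sum>a\<in>UNIV. w a * ?m $ a) = 1/2 * (\<Sum>a\<in>UNIV. w a * ?u $ a) + 1/2 * (\<Sum>a\<in>UNIV. w a * v $ a)"
    by (simp add: sum_distrib_left sum.distrib[symmetric] algebra_simps)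
  ultimately show ?thesis
    using 1 unfolding reg_cost_def by (simp add: algebra_simps)
qed

text \<open>Add the growth inequalities of the two problems, each tested at the minimiser of the
  other. The regulariser cancels, which bounds \<open>\<rho> / 2\<close> times the squared distance
  by a linear form in \<open>best w' - best w\<close>; one factor of the distance is then divided
  out.\<close>

lemma best_lipschitz: "l1_norm (best w - best w') \<le> 2 / \<rho> * (\<Sum>a\<in>UNIV. \<bar>w a - w' a\<bar>)"
proof (cases "l1_norm (best w - best w') = 0")
  case True
  then show ?thesis using rho_pos by (simp add: sum_nonneg)
next
  case False
  let ?l = "l1_norm (best w - best w')"
  have pos: "?l > 0" using False l1_norm_nonneg[of "best w - best w'"] by linarith
  have "\<rho> / 2 * ?l\<^sup>2 \<le> (reg_cost w (best w') - reg_cost w' (best w')) - (reg_cost w (best w) - reg_cost w' (best w))"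
    using reg_cost_growth[OF best_in, of w w'] reg_cost_growth[OF best_in, of w' w]
    by (simp add: l1_norm_minus_commute[of "best w'"])
  also have "\<dots> = (\<Sum>a\<in>UNIV. (w a - w' a) * (best w' - best w) $ a)"
    by (simp add: reg_cost_diff right_diff_distrib sum_subtractf)
  also have "\<dots> \<le> (\<Sum>a\<in>UNIV. \<bar>w a - w' a\<bar>) * ?l"
    using sum_mult_le_l1[of "\<lambda>a. w a - w' a" "best w' - best w"]
    by (simp add: l1_norm_minus_commute[of "best w'"])
  finally have "(\<rho> / 2 * ?l) * ?l \<le> (\<Sum>a\<in>UNIV. \<bar>w a - w' a\<bar>) * ?l"
    by (simp add: power2_eq_square mult.assoc)
  then have "\<rho> / 2 * ?l \<le> (\<Sum>a\<in>UNIV. \<bar>w a - w' a\<bar>)"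
    using pos by simp
  then show ?thesis using rho_pos by (simp add: field_simps)
qed

text \<open>Each minimum is at most the cost at the minimiser of the other problem, and that
  minimiser has \<open>l1_norm\<close> equal to 1.\<close>

lemma min_reg_cost_lipschitz:
  "\<bar>reg_cost w (best w) - reg_cost w' (best w')\<bar> \<le> (\<Sum>a\<in>UNIV. \<bar>w a - w' a\<bar>)"
proof -
  have "reg_cost w (best w) - reg_cost w' (best w') \<le> (\<Sum>a\<in>UNIV. \<bar>w a - w' a\<bar>)" for w w'
    using reg_cost_best_le[OF best_in, of w w'] reg_cost_diff[of w "best w'" w']
      sum_mult_le_l1[of "\<lambda>a. w a - w' a" "best w'"] l1_norm_prob_simplex[OF best_in, of w']
    by simp
  from this[of w w'] this[of w' w] show ?thesis
    by (simp add: abs_minus_commute abs_le_iff)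
qed

lemma tendsto_coefficient_distance:
  fixes w :: "'n \<Rightarrow> 'a \<Rightarrow> real"
  assumes "\<And>a. ((\<lambda>n. w n a) \<longlongrightarrow> w' a) F"
  shows "((\<lambda>n. \<Sum>a\<in>UNIV. \<bar>w n a - w' a\<bar>) \<longlongrightarrow> 0) F"
proof -
  have "((\<lambda>n. \<Sum>a\<in>UNIV. \<bar>w n a - w' a\<bar>) \<longlongrightarrow> (\<Sum>a\<in>UNIV. \<bar>w' a - w' a\<bar>)) F"
    by (intro tendsto_intros assms)
  then show ?thesis by simp
qed

lemma tendsto_best:
  assumes "\<And>a. ((\<lambda>n. w n a) \<longlongrightarrow> w' a) F"
  shows "((\<lambda>n. best (w n)) \<longlongrightarrow> best w') F"
proof (rule tendsto_via_l1_norm)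
  show "\<forall>\<^sub>F n in F. l1_norm (best (w n) - best w') \<le> 2 / \<rho> * (\<Sum>a\<in>UNIV. \<bar>w n a - w' a\<bar>)"
    by (intro always_eventually allI best_lipschitz)
  show "((\<lambda>n. 2 / \<rho> * (\<Sum>a\<in>UNIV. \<bar>w n a - w' a\<bar>)) \<longlongrightarrow> 0) F"
    by (intro tendsto_mult_right_zero tendsto_coefficient_distance assms)
qed

lemma tendsto_min_reg_cost:
  assumes "\<And>a. ((\<lambda>n. w n a) \<longlongrightarrow> w' a) F"
  shows "((\<lambda>n. reg_cost (w n) (best (w n))) \<longlongrightarrow> reg_cost w' (best w')) F"
proof (rule Lim_transform2[OF tendsto_const], rule Lim_null_comparison)
  show "\<forall>\<^sub>F n in F. norm (reg_cost w' (best w') - reg_cost (w n) (best (w n)))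
      \<le> (\<Sum>a\<in>UNIV. \<bar>w n a - w' a\<bar>)"
    by (intro always_eventually allI) (metis abs_minus_commute min_reg_cost_lipschitz real_norm_def)
qed (rule tendsto_coefficient_distance[OF assms])

section \<open>The operators acting on coefficients\<close>

definition backup :: "('x \<Rightarrow> 'a \<Rightarrow> real) \<Rightarrow> real ^ 'x \<Rightarrow> 'x \<Rightarrow> 'a \<Rightarrow> real" where
  "backup q \<mu> x a = c x a \<mu> + \<beta> * (\<Sum>y\<in>UNIV. reg_cost (q y) (best (q y)) * p x a \<mu> $ y)"

text \<open>Since \<open>mixed_kernel\<close> is linear in \<open>u\<close>, the expected
  continuation value is again a linear form in \<open>u\<close> and merges with the cost, while the
  regulariser is carried along unchanged.\<close>

lemma H1_reg_cost: "H1 c p \<beta> \<rho> \<Omega> (\<lambda>x. reg_cost (q x)) \<mu> = (\<lambda>x. reg_cost (backup q \<mu> x))"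
proof (intro ext)
  fix x u
  have "(\<Sum>y\<in>UNIV. reg_cost (q y) (best (q y)) * (\<Sum>a\<in>UNIV. p x a \<mu> $ y * u $ a))
      = (\<Sum>a\<in>UNIV. (\<Sum>y\<in>UNIV. reg_cost (q y) (best (q y)) * p x a \<mu> $ y) * u $ a)"
    unfolding sum_distrib_left sum_distrib_right by (subst sum.swap) (simp add: mult.assoc)
  moreover have "reg_cost (backup q \<mu> x) u = (\<Sum>a\<in>UNIV. c x a \<mu> * u $ a) + \<rho> * \<Omega> u
      + \<beta> * (\<Sum>a\<in>UNIV. (\<Sum>y\<in>UNIV. reg_cost (q y) (best (q y)) * p x a \<mu> $ y) * u $ a)"
    unfolding reg_cost_def[of "backup q \<mu> x"] backup_def distrib_right sum.distrib mult.assoc[of \<beta>]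
    by (simp flip: sum_distrib_left)
  ultimately show "H1 c p \<beta> \<rho> \<Omega> (\<lambda>x. reg_cost (q x)) \<mu> x u = reg_cost (backup q \<mu> x) u"
    unfolding H1_def INF_reg_cost by (simp add: mixed_kernel_def mixed_cost_def)
qed

definition next_state :: "('x \<Rightarrow> real ^ 'a) \<Rightarrow> real ^ 'x \<Rightarrow> real ^ 'x" where
  "next_state g \<mu> = (\<chi> y. \<Sum>x\<in>UNIV. mixed_kernel p x (g x) \<mu> $ y * \<mu> $ x)"

lemma H2_return:
  assumes "\<And>x. g x \<in> prob_simplex"
  shows "H2 p (\<lambda>x. return action_space (g x)) \<mu> = next_state g \<mu>"
proof -
  have "(\<integral>u. mixed_kernel p x u \<mu> $ y \<partial>return action_space (g x)) = mixed_kernel p x (g x) \<mu> $ y" for x y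
  proof (rule integral_return)
    show "(\<lambda>u. mixed_kernel p x u \<mu> $ y) \<in> borel_measurable action_space"
      unfolding mixed_kernel_def
      by (intro borel_measurable_action_space) (simp, intro continuous_intros)
  qed (simp add: space_action_space assms)
  then show ?thesis by (simp add: H2_def next_state_def)
qed

lemma next_state_in:
  assumes "\<And>x. g x \<in> prob_simplex" "\<mu> \<in> prob_simplex"
  shows "next_state g \<mu> \<in> prob_simplex"
  unfolding next_state_def mixed_kernel_def
  by (intro prob_simplex_combination assms kernel)

text \<open>Membership in the simplex is asked only eventually, because a family with horizon
  \<open>T\<close> is constrained at index \<open>t\<close> only once
  \<open>t \<le> T\<close>.\<close>

lemma tendsto_model:
  assumes lim: "(\<mu> \<longlongrightarrow> m) F" and ev: "\<forall>\<^sub>F n in F. \<mu> n \<in> prob_simplex" and m: "m \<in> prob_simplex"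
  shows "((\<lambda>n. c x a (\<mu> n)) \<longlongrightarrow> c x a m) F" and "((\<lambda>n. p x a (\<mu> n)) \<longlongrightarrow> p x a m) F"
proof -
  have "\<bar>c x a \<nu> - c x a m\<bar> \<le> L * l1_norm (\<nu> - m) \<and>
      l1_norm (p x a \<nu> - p x a m) \<le> K * l1_norm (\<nu> - m)" if "\<nu> \<in> prob_simplex" for \<nu>
    using lipschitz[unfolded lipschitz_model_def, rule_format, OF that m, where x = x and x' = x and a = a and a' = a] by simp
  then have 1: "\<forall>\<^sub>F n in F. \<bar>c x a (\<mu> n) - c x a m\<bar> \<le> L * l1_norm (\<mu> n - m)"
    and 2: "\<forall>\<^sub>F n in F. l1_norm (p x a (\<mu> n) - p x a m) \<le> K * l1_norm (\<mu> n - m)"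
    using ev by (auto elim!: eventually_mono)
  note lim0 = tendsto_l1_norm_diff[OF lim]
  show "((\<lambda>n. p x a (\<mu> n)) \<longlongrightarrow> p x a m) F"
    by (rule tendsto_via_l1_norm[OF 2 tendsto_mult_right_zero[OF lim0]])
  have "((\<lambda>n. c x a (\<mu> n) - c x a m) \<longlongrightarrow> 0) F"
    by (rule Lim_null_comparison[OF _ tendsto_mult_right_zero[OF lim0, of L]]) (use 1 in simp)
  then show "((\<lambda>n. c x a (\<mu> n)) \<longlongrightarrow> c x a m) F"
    by (rule LIM_zero_cancel)
qed

lemma tendsto_backup:
  assumes "\<And>x a. ((\<lambda>n. q n x a) \<longlongrightarrow> q' x a) F"
    and "(\<mu> \<longlongrightarrow> m) F" "\<forall>\<^sub>F n in F. \<mu> n \<in> prob_simplex" "m \<in> prob_simplex"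
  shows "((\<lambda>n. backup (q n) (\<mu> n) x a) \<longlongrightarrow> backup q' m x a) F"
  unfolding backup_def
  by (intro tendsto_intros tendsto_min_reg_cost tendsto_model assms)

lemma tendsto_next_state:
  assumes "\<And>x. ((\<lambda>n. g n x) \<longlongrightarrow> g' x) F"
    and "(\<mu> \<longlongrightarrow> m) F" "\<forall>\<^sub>F n in F. \<mu> n \<in> prob_simplex" "m \<in> prob_simplex"
  shows "((\<lambda>n. next_state (g n) (\<mu> n)) \<longlongrightarrow> next_state g' m) F"
  unfolding next_state_def mixed_kernel_def
  by (simp, intro vec_tendstoI, simp) (intro tendsto_intros tendsto_model assms)

section \<open>Equilibria reconstructed from the state flow\<close>

text \<open>Going backwards in time is going up in \<open>t\<close>: the coefficients at
  \<open>t\<close> depend on the terminal ones and on \<open>\<mu> 1\<close>, ...,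
  \<open>\<mu> t\<close>. Q-functions are thus functions of the flow and not further
  unknowns.\<close>

primrec coef :: "('x \<Rightarrow> 'a \<Rightarrow> real) \<Rightarrow> (nat \<Rightarrow> real ^ 'x) \<Rightarrow> nat \<Rightarrow> 'x \<Rightarrow> 'a \<Rightarrow> real" where
  "coef q \<mu> 0 = q"
| "coef q \<mu> (Suc t) = backup (coef q \<mu> t) (\<mu> (Suc t))"

lemma tendsto_coef:
  assumes "\<And>x a. ((\<lambda>n. q n x a) \<longlongrightarrow> q' x a) F"
    and "\<And>t. ((\<lambda>n. \<mu> n t) \<longlongrightarrow> m t) F" "\<And>t. \<forall>\<^sub>F n in F. \<mu> n t \<in> prob_simplex" "\<And>t. m t \<in> prob_simplex"
  shows "((\<lambda>n. coef (q n) (\<mu> n) t x a) \<longlongrightarrow> coef q' m t x a) F"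
proof (induction t arbitrary: x a)
  case (Suc t)
  then show ?case by (simp add: tendsto_backup assms)
qed (simp add: assms)

definition reply :: "('x \<Rightarrow> 'a \<Rightarrow> real) \<Rightarrow> (nat \<Rightarrow> real ^ 'x) \<Rightarrow> nat \<Rightarrow> 'x \<Rightarrow> real ^ 'a" where
  "reply q \<mu> t x = best (coef q \<mu> t x)"

lemma reply_in: "reply q \<mu> t x \<in> prob_simplex"
  by (simp add: reply_def best_in)

lemma tendsto_reply:
  assumes "\<And>x a. ((\<lambda>n. q n x a) \<longlongrightarrow> q' x a) F"
    and "\<And>t. ((\<lambda>n. \<mu> n t) \<longlongrightarrow> m t) F" "\<And>t. \<forall>\<^sub>F n in F. \<mu> n t \<in> prob_simplex" "\<And>t. m t \<in> prob_simplex"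
  shows "((\<lambda>n. reply (q n) (\<mu> n) t x) \<longlongrightarrow> reply q' m t x) F"
  unfolding reply_def by (intro tendsto_best tendsto_coef assms)

text \<open>The Q-functions are rebuilt by \<open>coef\<close> and the policies as Dirac masses at
  \<open>reply\<close>, so optimality and the recursion hold by construction and the state evolution
  is the one condition left on \<open>\<mu>\<close>.\<close>

lemma TRMFE_reply:
  assumes "\<And>t. \<mu> t \<in> prob_simplex"
    and "\<And>t. \<mu> t = next_state (reply q \<mu> (Suc t)) (\<mu> (Suc t))"
  shows "(\<lambda>t x. return action_space (reply q \<mu> t x), \<mu>) \<in> TRMFE c p \<beta> \<rho> \<Omega> (\<lambda>x. reg_cost (q x))"
  unfolding TRMFE_def mem_Collect_eq case_prod_conv
proof (intro conjI exI[of _ "\<lambda>t x. reg_cost (coef q \<mu> t x)"] allI)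
  fix t
  show "(\<lambda>x. return action_space (reply q \<mu> t x)) \<in> policies"
    by (simp add: return_policies reply_in)
  show "supported_on_minimizers (\<lambda>x. return action_space (reply q \<mu> t x)) (\<lambda>x. reg_cost (coef q \<mu> t x))"
    unfolding supported_on_minimizers_def is_arg_min_reg_cost_iff
  proof
    fix x
    have "Measurable.pred action_space (\<lambda>u. u = reply q \<mu> t x)"
      unfolding action_space_def by (intro measurable_restrict_space1) (simp add: pred_def)
    then show "AE u in return action_space (reply q \<mu> t x). u = best (coef q \<mu> t x)"
      by (simp add: AE_return space_action_space reply_in flip: reply_def)
  qed
  show "\<mu> t = H2 p (\<lambda>x. return action_space (reply q \<mu> (Suc t) x)) (\<mu> (Suc t))"
    unfolding H2_return[OF reply_in] by (rule assms(2))
qed (simp_all add: assms(1) H1_reg_cost)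

section \<open>Existence on the infinite horizon\<close>

lemma TRMFE_nonempty: "TRMFE c p \<beta> \<rho> \<Omega> (\<lambda>x. reg_cost (q x)) \<noteq> {}"
proof -
  define C where "C = {y :: nat \<Rightarrow> real. \<forall>i. y i \<in> {0..1}}"
  \<comment> \<open>A flow is a point of the Hilbert cube; \<open>proj\<close> retracts the cube onto the genuine flows, so that
    \<open>f\<close> is defined everywhere and its fixed points are flows.\<close>
  define flow :: "(nat \<Rightarrow> real) \<Rightarrow> nat \<Rightarrow> real ^ 'x" where "flow y t = (\<chi> x. y (to_nat (t, x)))" for y t
  define proj where "proj y t = closest_point prob_simplex (flow y t)" for y t
  \<comment> \<open>Entry \<open>t\<close> of the image depends only on the entries \<open>1\<close>
    to \<open>Suc t\<close> of \<open>m\<close>, so coordinatewise convergence of flows is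
    preserved.\<close>
  define \<Phi> where "\<Phi> m t = next_state (reply q m (Suc t)) (m (Suc t))" for m t
  define f where "f y i = (case from_nat i of (t, x) \<Rightarrow> \<Phi> (proj y) t $ x)" for y i
  have proj_in: "proj y t \<in> prob_simplex" for y t
    unfolding proj_def using axis_in_prob_simplex
    by (intro closest_point_in_set closed_prob_simplex) blast
  have \<Phi>_in: "\<Phi> m t \<in> prob_simplex" if "\<And>t. m t \<in> prob_simplex" for m t
    unfolding \<Phi>_def by (intro next_state_in reply_in that)
  have "f y i \<in> {0..1}" for y i
    unfolding f_def using prob_simplex_component[OF \<Phi>_in, of "proj y", OF proj_in]
    by (simp split: prod.split)
  then have "f \<in> C \<rightarrow> C"
    unfolding C_def by simp
  moreover have "continuous_on C f"
  proof (rule continuous_on_sequentiallyI)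
    fix u l assume "u \<longlonglongrightarrow> (l :: nat \<Rightarrow> real)"
    then have "(\<lambda>n. flow (u n) t) \<longlonglongrightarrow> flow l t" for t
      unfolding flow_def by (intro vec_tendstoI) (simp add: tendsto_fun_iff)
    then have "(\<lambda>n. proj (u n) t) \<longlonglongrightarrow> proj l t" for t
      unfolding proj_def using axis_in_prob_simplex
      by (intro continuous_on_tendsto_compose[OF continuous_on_closest_point[where t = UNIV]]
          convex_prob_simplex closed_prob_simplex) auto
    then have "(\<lambda>n. \<Phi> (proj (u n)) t) \<longlonglongrightarrow> \<Phi> (proj l) t" for t
      unfolding \<Phi>_def by (intro tendsto_next_state tendsto_reply) (auto simp: proj_in)
    then show "(\<lambda>n. f (u n)) \<longlonglongrightarrow> f l"
      unfolding tendsto_fun_iff f_def by (auto split: prod.split intro!: tendsto_vec_nth)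
  qed
  ultimately obtain y where y: "f y = y"
    using hilbert_cube_fixed_point[of f] unfolding C_def by blast
  have flow_eq: "flow y t = \<Phi> (proj y) t" for t
  proof (rule vec_eq_iff[THEN iffD2], rule)
    fix x
    show "flow y t $ x = \<Phi> (proj y) t $ x"
      using fun_cong[OF y, of "to_nat (t, x)"] by (simp add: flow_def f_def)
  qed
  \<comment> \<open>At a fixed point the flow is a value of \<open>\<Phi>\<close> and so already
    lies in the simplex, where the projection is the identity.\<close>
  then have proj_eq: "proj y = flow y"
    unfolding proj_def by (auto intro!: closest_point_self \<Phi>_in proj_in simp flip: proj_def)
  have "(\<lambda>t x. return action_space (reply q (flow y) t x), flow y)
      \<in> TRMFE c p \<beta> \<rho> \<Omega> (\<lambda>x. reg_cost (q x))"
  proof (rule TRMFE_reply)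
    show "flow y t \<in> prob_simplex" for t
      using proj_in[of y t] by (simp add: proj_eq)
    show "flow y t = next_state (reply q (flow y) (Suc t)) (flow y (Suc t))" for t
      using flow_eq[of t] unfolding proj_eq \<Phi>_def .
  qed
  then show ?thesis by blast
qed

section \<open>Finite horizon equilibria and their accumulation points\<close>

text \<open>By induction on \<open>t\<close> the Q-functions keep the form \<open>reg_cost\<close>
  with coefficients \<open>coef\<close>, and uniqueness of the minimiser leaves the policy no
  freedom. The whole family is thereby expressed through \<open>\<mu>\<close> and
  \<open>q\<close>.\<close>

lemma MFE_pure:
  assumes "(\<pi>, \<mu>) \<in> MFE c p \<beta> \<rho> \<Omega> T m (\<lambda>x. reg_cost (q x))"
  shows "\<And>t. t \<le> T \<Longrightarrow> \<mu> t \<in> prob_simplex"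
    and "\<And>t. t \<le> T \<Longrightarrow> \<pi> t = (\<lambda>x. return action_space (reply q \<mu> t x))"
    and "\<And>t. t < T \<Longrightarrow> \<mu> t = next_state (reply q \<mu> (Suc t)) (\<mu> (Suc t))"
proof -
  obtain Q where policy: "\<And>t. t \<le> T \<Longrightarrow> \<pi> t \<in> policies"
    and simplex: "\<And>t. t \<le> T \<Longrightarrow> \<mu> t \<in> prob_simplex"
    and Q0: "Q 0 = (\<lambda>x. reg_cost (q x))"
    and QSuc: "\<And>t. t < T \<Longrightarrow> Q (Suc t) = H1 c p \<beta> \<rho> \<Omega> (Q t) (\<mu> (Suc t))"
    and \<mu>: "\<And>t. t < T \<Longrightarrow> \<mu> t = H2 p (\<pi> (Suc t)) (\<mu> (Suc t))"
    and supp: "\<And>t. t \<le> T \<Longrightarrow> supported_on_minimizers (\<pi> t) (Q t)"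
    using assms by (auto simp: MFE_def)
  show "\<And>t. t \<le> T \<Longrightarrow> \<mu> t \<in> prob_simplex" by (fact simplex)
  have Q: "t \<le> T \<Longrightarrow> Q t = (\<lambda>x. reg_cost (coef q \<mu> t x))" for t
    by (induction t) (simp_all add: Q0 QSuc H1_reg_cost)
  show pure: "\<pi> t = (\<lambda>x. return action_space (reply q \<mu> t x))" if "t \<le> T" for t
  proof
    fix x
    show "\<pi> t x = return action_space (reply q \<mu> t x)"
    proof (rule eq_return_if_AE_const)
      show "\<pi> t x \<in> space (prob_algebra action_space)"
        using policy[OF that] by (auto simp: policies_def)
      show "AE u in \<pi> t x. u = reply q \<mu> t x"
        using supp[OF that] unfolding supported_on_minimizers_def Q[OF that] is_arg_min_reg_cost_iff
        by (simp add: reply_def)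
    qed (simp add: space_action_space reply_in)
  qed
  show "\<mu> t = next_state (reply q \<mu> (Suc t)) (\<mu> (Suc t))" if "t < T" for t
    using \<mu>[OF that] pure[of "Suc t"] that by (simp add: H2_return reply_in)
qed

lemma MFE_accumulation_point:
  fixes z :: "nat \<Rightarrow> ('x \<times> (real ^ 'a)) measure"
  assumes MFE: "\<And>T. (\<pi>\<^sub>T T, \<mu>\<^sub>T T) \<in> MFE c p \<beta> \<rho> \<Omega> T m (\<lambda>x. reg_cost (q\<^sub>T T x))"
    and q: "\<And>x a. (\<lambda>T. q\<^sub>T T x a) \<longlonglongrightarrow> q x a"
    and acc: "accumulation_point (product_topology (\<lambda>_. occupancy_topology) UNIV)
         (\<lambda>T t. if t \<le> T then occupancy (\<pi>\<^sub>T T t) (\<mu>\<^sub>T T t) else \<nu>) z"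
  shows "\<exists>(\<pi>, \<mu>) \<in> TRMFE c p \<beta> \<rho> \<Omega> (\<lambda>x. reg_cost (q x)). \<forall>t. z t = occupancy (\<pi> t) (\<mu> t)"
proof -
  define s where "s T t = (if t \<le> T then occupancy (\<pi>\<^sub>T T t) (\<mu>\<^sub>T T t) else \<nu>)" for T t
  obtain F where F: "F \<noteq> bot" "F \<le> sequentially"
    and "limitin (product_topology (\<lambda>_. occupancy_topology) UNIV) s z F"
    using accumulation_point_imp_limitin[OF acc] unfolding s_def by blast
  then have lim: "limitin occupancy_topology (\<lambda>T. s T t) (z t) F" for t
    by (simp add: limitin_componentwise)
  have z: "z t \<in> space (prob_algebra state_action_space)" for t
    using limitin_topspace[OF lim, of t] topspace_weak_topology_subset
    unfolding occupancy_topology_def by blast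
  \<comment> \<open>\<open>F\<close> refines \<open>sequentially\<close>, so every fixed time
    eventually lies within the horizon and the filler \<open>\<nu>\<close> disappears.\<close>
  have ev: "\<forall>\<^sub>F T in F. t \<le> T" for t
    using F(2) eventually_ge_at_top filter_leD by blast
  define g where "g T t = reply (q\<^sub>T T) (\<mu>\<^sub>T T) t" for T t
  \<comment> \<open>The state marginal of \<open>z t\<close>, written with a test function that is
    continuous because the state space is discrete.\<close>
  define \<mu> :: "nat \<Rightarrow> real ^ 'x" where "\<mu> t = (\<chi> x. \<integral>w. of_bool (fst w = x) \<partial>z t)" for t
  note pure = MFE_pure[OF MFE]
  have lim_integral: "((\<lambda>T. \<Sum>x\<in>UNIV. \<mu>\<^sub>T T t $ x * f (x, g T t x)) \<longlongrightarrow> (\<integral>w. f w \<partial>z t)) F"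
    if f: "\<And>x. continuous_on prob_simplex (\<lambda>v. f (x, v))" "\<And>w. \<bar>f w\<bar> \<le> B" for f B t
  proof -
    have "f \<in> borel_measurable state_action_space"
      by (intro measurable_state_action_spaceI borel_measurable_action_space f)
    then have "(\<integral>w. f w \<partial>s T t) = (\<Sum>x\<in>UNIV. \<mu>\<^sub>T T t $ x * f (x, g T t x))" if "t \<le> T" for T
      using that pure(1,2)[OF that] by (simp add: s_def integral_occupancy_return reply_in g_def)
    then have "\<forall>\<^sub>F T in F. (\<integral>w. f w \<partial>s T t) = (\<Sum>x\<in>UNIV. \<mu>\<^sub>T T t $ x * f (x, g T t x))"
      using ev[of t] by (rule eventually_mono[rotated]) simp
    moreover have "((\<lambda>T. \<integral>w. f w \<partial>s T t) \<longlongrightarrow> (\<integral>w. f w \<partial>z t)) F"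
      by (rule limitin_occupancy_topology_integral[OF lim f])
    ultimately show ?thesis
      by (rule Lim_transform_eventually[rotated])
  qed
  have lim_\<mu>: "((\<lambda>T. \<mu>\<^sub>T T t) \<longlongrightarrow> \<mu> t) F" for t
  proof (rule vec_tendstoI)
    fix x
    show "((\<lambda>T. \<mu>\<^sub>T T t $ x) \<longlongrightarrow> \<mu> t $ x) F"
      using lim_integral[of "\<lambda>w. of_bool (fst w = x)" 1 t] by (simp add: \<mu>_def if_distrib)
  qed
  have simplex_ev: "\<forall>\<^sub>F T in F. \<mu>\<^sub>T T t \<in> prob_simplex" for t
    using ev[of t] by eventually_elim (rule pure(1))
  have \<mu>_in: "\<mu> t \<in> prob_simplex" for t
    by (rule Lim_in_closed_set[OF closed_prob_simplex simplex_ev F(1) lim_\<mu>])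
  have lim_q: "((\<lambda>T. q\<^sub>T T x a) \<longlongrightarrow> q x a) F" for x a
    using q F(2) by (rule tendsto_mono[rotated])
  have lim_g: "((\<lambda>T. g T t x) \<longlongrightarrow> reply q \<mu> t x) F" for t x
    unfolding g_def by (intro tendsto_reply lim_q lim_\<mu> simplex_ev \<mu>_in)
  have "\<mu> t = next_state (reply q \<mu> (Suc t)) (\<mu> (Suc t))" for t
  proof (rule tendsto_unique[OF F(1) lim_\<mu>])
    \<comment> \<open>The evolution equation links \<open>t\<close> to \<open>Suc t\<close> and
      holds for \<open>t < T\<close>, hence \<open>ev\<close> is used at
      \<open>Suc t\<close>.\<close>
    have "\<forall>\<^sub>F T in F. next_state (g T (Suc t)) (\<mu>\<^sub>T T (Suc t)) = \<mu>\<^sub>T T t"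
      using ev[of "Suc t"] by eventually_elim (simp add: pure(3)[of t] g_def)
    moreover have "((\<lambda>T. next_state (g T (Suc t)) (\<mu>\<^sub>T T (Suc t)))
        \<longlongrightarrow> next_state (reply q \<mu> (Suc t)) (\<mu> (Suc t))) F"
      by (intro tendsto_next_state lim_g lim_\<mu> simplex_ev \<mu>_in)
    ultimately show "((\<lambda>T. \<mu>\<^sub>T T t) \<longlongrightarrow> next_state (reply q \<mu> (Suc t)) (\<mu> (Suc t))) F"
      by (rule Lim_transform_eventually[rotated])
  qed
  with \<mu>_in have "(\<lambda>t x. return action_space (reply q \<mu> t x), \<mu>)
      \<in> TRMFE c p \<beta> \<rho> \<Omega> (\<lambda>x. reg_cost (q x))"
    by (rule TRMFE_reply)
  moreover have "z t = occupancy (\<lambda>x. return action_space (reply q \<mu> t x)) (\<mu> t)" for t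
  proof (rule eq_occupancy_returnI[OF z reply_in])
    show "(\<integral>w. of_bool (fst w = x) \<partial>z t) = \<mu> t $ x" for x
      by (simp add: \<mu>_def)
    define f where "f w = min 1 (dist (snd w) (reply q \<mu> t (fst w)))" for w
    have cont: "continuous_on prob_simplex (\<lambda>v. f (x, v))" for x
      unfolding f_def by (simp, intro continuous_intros)
    have bound: "\<bar>f w\<bar> \<le> 1" for w
      by (simp add: f_def)
    \<comment> \<open>Against a deterministic occupancy measure the integral is a finite sum over
      states, and each distance in it tends to 0 by \<open>lim_g\<close>. The truncation at 1 keeps
      \<open>f\<close> bounded without changing its zero set, the graph of the limiting
      reply.\<close>
    have "((\<lambda>T. \<Sum>x\<in>UNIV. \<mu>\<^sub>T T t $ x * f (x, g T t x)) \<longlongrightarrow>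
        (\<Sum>x\<in>UNIV. \<mu> t $ x * min 1 (dist (reply q \<mu> t x) (reply q \<mu> t x)))) F"
      unfolding f_def fst_conv snd_conv by (intro tendsto_intros lim_g lim_\<mu>)
    then have int0: "(\<integral>w. f w \<partial>z t) = 0"
      using tendsto_unique[OF F(1) lim_integral[OF cont bound]] by simp
    have sets: "sets (z t) = sets state_action_space" and "prob_space (z t)"
      using z[of t] by (simp_all add: space_prob_algebra)
    interpret prob_space "z t" by fact
    have "f \<in> borel_measurable (z t)"
      unfolding measurable_cong_sets[OF sets refl]
      by (intro measurable_state_action_spaceI borel_measurable_action_space cont)
    then have "integrable (z t) f"
      using bound by (intro integrable_const_bound[of _ 1]) auto
    moreover have "AE w in z t. 0 \<le> f w"
      by (simp add: f_def)
    ultimately have "AE w in z t. f w = 0"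
      using int0 integral_nonneg_eq_0_iff_AE by blast
    then show "AE w in z t. snd w = reply q \<mu> t (fst w)"
      by (rule eventually_mono) (auto simp: f_def min_def split: if_splits)
  qed
  ultimately show ?thesis
    by (intro bexI[of _ "(\<lambda>t x. return action_space (reply q \<mu> t x), \<mu>)"]) auto
qed

end

section \<open>Terminal conditions and conclusion\<close>

text \<open>The regulariser cancels in the difference of the Q-functions, whose value at the vertex
  \<open>axis a 1\<close> is exactly the difference of the coefficients of \<open>a\<close>.\<close>

lemma tendsto_coefficient_if_sup_norm:
  fixes q :: "'x::finite \<Rightarrow> 'a::finite \<Rightarrow> real"
  assumes "(\<lambda>T. sup_norm (UNIV \<times> prob_simplex) (\<lambda>(x, u).
      ((\<Sum>a\<in>UNIV. q\<^sub>T T x a * u $ a) + r u) - ((\<Sum>a\<in>UNIV. q x a * u $ a) + r u))) \<longlonglongrightarrow> 0"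
  shows "(\<lambda>T. q\<^sub>T T x a) \<longlonglongrightarrow> q x a"
proof -
  have "\<bar>q\<^sub>T T x a - q x a\<bar> \<le> sup_norm (UNIV \<times> prob_simplex) (\<lambda>(x, u).
      ((\<Sum>a\<in>UNIV. q\<^sub>T T x a * u $ a) + r u) - ((\<Sum>a\<in>UNIV. q x a * u $ a) + r u))" for T
  proof -
    let ?d = "\<lambda>(x, u :: real ^ 'a). ((\<Sum>a\<in>UNIV. q\<^sub>T T x a * u $ a) + r u) - ((\<Sum>a\<in>UNIV. q x a * u $ a) + r u)"
    have d: "?d (x, u) = (\<Sum>a\<in>UNIV. (q\<^sub>T T x a - q x a) * u $ a)" for x and u :: "real ^ 'a"
      by (simp add: sum_subtractf left_diff_distrib)
    \<comment> \<open>\<open>sup_norm\<close> is a supremum of reals and dominates the single values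
      only after boundedness is known; this bound is uniform in \<open>x\<close> and
      \<open>u\<close>.\<close>
    have "\<bar>?d (x, u)\<bar> \<le> (\<Sum>x\<in>UNIV. \<Sum>a\<in>UNIV. \<bar>q\<^sub>T T x a - q x a\<bar>)" if "u \<in> prob_simplex" for x u
    proof -
      have "\<bar>?d (x, u)\<bar> \<le> (\<Sum>a\<in>UNIV. \<bar>q\<^sub>T T x a - q x a\<bar>)"
        unfolding d using sum_mult_le_l1[of "\<lambda>a. q\<^sub>T T x a - q x a" u] l1_norm_prob_simplex[OF that] by simp
      also have "\<dots> \<le> (\<Sum>x\<in>UNIV. \<Sum>a\<in>UNIV. \<bar>q\<^sub>T T x a - q x a\<bar>)"
        by (rule member_le_sum) (auto intro: sum_nonneg)
      finally show ?thesis .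
    qed
    then have "bdd_above ((\<lambda>w. \<bar>?d w\<bar>) ` (UNIV \<times> prob_simplex))"
      by (intro bdd_aboveI2) blast
    then have "\<bar>?d (x, axis a 1)\<bar> \<le> sup_norm (UNIV \<times> prob_simplex) ?d"
      unfolding sup_norm_def by (rule cSUP_upper[rotated]) (simp add: axis_in_prob_simplex)
    then show ?thesis
      unfolding d by (simp add: axis_def if_distrib cong: if_cong)
  qed
  then have "(\<lambda>T. q\<^sub>T T x a - q x a) \<longlonglongrightarrow> 0"
    by (intro Lim_null_comparison[OF _ assms]) auto
  then show ?thesis by (rule LIM_zero_cancel)
qed

theorem theorem1:
  fixes c :: "'x::finite \<Rightarrow> 'a::finite \<Rightarrow> real ^ 'x \<Rightarrow> real"
    and p :: "'x \<Rightarrow> 'a \<Rightarrow> real ^ 'x \<Rightarrow> real ^ 'x"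
    and \<Omega> :: "real ^ 'a \<Rightarrow> real"
    and \<beta> \<rho> L\<^sub>1 K\<^sub>1 :: real
  assumes "0 < \<beta>" and "\<beta> < 1" and "0 < \<rho>"
    and "\<And>x a \<mu>. \<mu> \<in> prob_simplex \<Longrightarrow> 0 \<le> c x a \<mu>"
    and "\<And>x a \<mu>. \<mu> \<in> prob_simplex \<Longrightarrow> p x a \<mu> \<in> prob_simplex"
    and "strongly_convex_l1 \<Omega>"
    and "unique_minimizers \<rho> \<Omega>"
    and "lipschitz_model L\<^sub>1 K\<^sub>1 c p"
    and "\<beta> * K\<^sub>1 < 2"
  shows "(\<forall>Q_terminal \<in> C_beta c \<beta> \<rho> \<Omega> L\<^sub>1 K\<^sub>1. TRMFE c p \<beta> \<rho> \<Omega> Q_terminal \<noteq> {}) \<and>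
    (\<forall>\<mu>_initial \<in> prob_simplex.
     \<forall>(Q\<^sub>T :: nat \<Rightarrow> 'x \<Rightarrow> real ^ 'a \<Rightarrow> real)
      (\<pi>\<^sub>T :: nat \<Rightarrow> nat \<Rightarrow> 'x \<Rightarrow> (real ^ 'a) measure)
      (\<mu>\<^sub>T :: nat \<Rightarrow> nat \<Rightarrow> real ^ 'x).
     \<forall>\<nu> \<in> space (prob_algebra state_action_space).
     \<forall>Q_terminal \<in> C_beta c \<beta> \<rho> \<Omega> L\<^sub>1 K\<^sub>1.
     \<forall>z :: nat \<Rightarrow> ('x \<times> (real ^ 'a)) measure.
       (\<forall>T. Q\<^sub>T T \<in> C_beta c \<beta> \<rho> \<Omega> L\<^sub>1 K\<^sub>1) \<longrightarrow>
       (\<forall>T. (\<pi>\<^sub>T T, \<mu>\<^sub>T T) \<in> MFE c p \<beta> \<rho> \<Omega> T \<mu>_initial (Q\<^sub>T T)) \<longrightarrow>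
       (\<lambda>T. sup_norm (UNIV \<times> prob_simplex) (\<lambda>(x, u). Q\<^sub>T T x u - Q_terminal x u))
         \<longlonglongrightarrow> 0 \<longrightarrow>
       accumulation_point (product_topology (\<lambda>_. occupancy_topology) UNIV)
         (\<lambda>T t. if t \<le> T then occupancy (\<pi>\<^sub>T T t) (\<mu>\<^sub>T T t) else \<nu>) z \<longrightarrow>
       (\<exists>(\<pi>, \<mu>) \<in> TRMFE c p \<beta> \<rho> \<Omega> Q_terminal. \<forall>t. z t = occupancy (\<pi> t) (\<mu> t)))"
proof -
  interpret regularized_model c p \<Omega> \<beta> \<rho> L\<^sub>1 K\<^sub>1
    by unfold_locales (fact assms)+
  \<comment> \<open>Passes from members of \<open>C_beta\<close> to coefficients, the form in which
    existence and the limit result are stated.\<close>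
  have rep: "\<exists>q. Q = (\<lambda>x. reg_cost (q x))" if "Q \<in> C_beta c \<beta> \<rho> \<Omega> L\<^sub>1 K\<^sub>1" for Q
    using that by (auto simp: C_beta_def reg_cost_def fun_eq_iff)
  show ?thesis
  proof (intro conjI ballI allI impI)
    fix Q assume "Q \<in> C_beta c \<beta> \<rho> \<Omega> L\<^sub>1 K\<^sub>1"
    then show "TRMFE c p \<beta> \<rho> \<Omega> Q \<noteq> {}"
      using rep TRMFE_nonempty by blast
  next
    fix m Q\<^sub>T \<pi>\<^sub>T \<mu>\<^sub>T \<nu> Q z
    assume Q: "Q \<in> C_beta c \<beta> \<rho> \<Omega> L\<^sub>1 K\<^sub>1"
      and QT: "\<forall>T. Q\<^sub>T T \<in> C_beta c \<beta> \<rho> \<Omega> L\<^sub>1 K\<^sub>1"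
      and MFE: "\<forall>T. (\<pi>\<^sub>T T, \<mu>\<^sub>T T) \<in> MFE c p \<beta> \<rho> \<Omega> T m (Q\<^sub>T T)"
      and lim: "(\<lambda>T. sup_norm (UNIV \<times> prob_simplex) (\<lambda>(x, u). Q\<^sub>T T x u - Q x u)) \<longlonglongrightarrow> 0"
      and acc: "accumulation_point (product_topology (\<lambda>_. occupancy_topology) UNIV)
         (\<lambda>T t. if t \<le> T then occupancy (\<pi>\<^sub>T T t) (\<mu>\<^sub>T T t) else \<nu>) z"
    obtain q where q: "Q = (\<lambda>x. reg_cost (q x))"
      using rep[OF Q] by blast
    obtain q\<^sub>T where qT: "\<And>T. Q\<^sub>T T = (\<lambda>x. reg_cost (q\<^sub>T T x))"
      using choice[of "\<lambda>T q. Q\<^sub>T T = (\<lambda>x. reg_cost (q x))"] rep QT by blast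
    have "(\<lambda>T. q\<^sub>T T x a) \<longlonglongrightarrow> q x a" for x a
      using lim unfolding q qT reg_cost_def by (rule tendsto_coefficient_if_sup_norm)
    then show "\<exists>(\<pi>, \<mu>) \<in> TRMFE c p \<beta> \<rho> \<Omega> Q. \<forall>t. z t = occupancy (\<pi> t) (\<mu> t)"
      using MFE acc unfolding q qT by (intro MFE_accumulation_point) auto
  qed
qed

end
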